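(* Let $Q=\{x\in\mathbb{R}^n\mid Ax\le b\}$ be a nonempty polyhedron, let $\psi:\mathbb{R}^n\to(-\infty,\infty]$ be proper and convex, let $z\in\mathrm{vert}(Q)$, $\varepsilon\ge 0$, and $T=N(z)$. For any subgradient $w\in\partial(\varepsilon\psi)(z)\cap T$, $$\gamma\big(T\cap[T+\partial(\varepsilon\psi)(z)]\big)\ \ge\ \gamma(T)\exp\Big(-\tfrac12\|w\|^2-\|w\|\sqrt n\Big).$$ If $\psi$ is differentiable at $z$, then $$\gamma\big(T\cap[T+\varepsilon\nabla\psi(z)]\big)\ \le\ \gamma(T)\exp\Big(-\tfrac12\|\mathrm{proj}_{T^*}\,\varepsilon\nabla\psi(z)\|^2+\mathrm{dist}(\varepsilon\nabla\psi(z),T^* )\sqrt n\Big).$$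
   Context: $\mathrm{vert}(Q)$ is the set of vertices (extreme points) of $Q$. $N(x)=\{v\in\mathbb{R}^n\mid v\cdot(y-x)\le 0\ \text{for all } y\in Q\}$ is the normal cone to $Q$ at $x\in Q$. $\gamma$ is the standard Gaussian measure on $\mathbb{R}^n$. $T^*=\{y\mid y\cdot x\ge 0\ \text{for all }x\in T\}$ is the dual cone, $\mathrm{dist}(w,A)=\inf_{a\in A}\|w-a\|$, and $\mathrm{proj}_A$ is Euclidean projection onto a closed convex set $A$. Convention: for $\varepsilon>0$, $\varepsilon\psi$ is the usual scalar multiple; for $\varepsilon=0$, $\varepsilon\psi$ denotes the indicator function $\delta_{\mathrm{dom}\,\psi}$ (equal to $0$ on $\mathrm{dom}\,\psi$ and $+\infty$ elsewhere). $\partial$ is the convex subdifferential. Sums of sets are Minkowski sums. *)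

theory Defs
  imports "HOL-Analysis.Analysis"
begin

definition normal_cone :: "'a::real_inner set \<Rightarrow> 'a \<Rightarrow> 'a set" where
  "normal_cone Q x = {v. \<forall>y\<in>Q. v \<bullet> (y - x) \<le> 0}"

definition dual_cone :: "'a::real_inner set \<Rightarrow> 'a set" where
  "dual_cone T = {y. \<forall>x\<in>T. y \<bullet> x \<ge> 0}"

definition std_gaussian :: "(real ^ 'n) measure" where
  "std_gaussian = density lborel
     (\<lambda>x. ennreal ((2 * pi) powr (- real CARD('n) / 2) * exp (- (norm x)\<^sup>2 / 2)))"

definition eff_dom :: "('a \<Rightarrow> ereal) \<Rightarrow> 'a set" where
  "eff_dom f = {x. f x < \<infinity>}"

definition proper_fun :: "('a \<Rightarrow> ereal) \<Rightarrow> bool" where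
  "proper_fun f \<longleftrightarrow> (\<forall>x. f x \<noteq> -\<infinity>) \<and> eff_dom f \<noteq> {}"

(* Weights are strictly between 0 and 1, so the products below never involve
   the ereal convention 0 * \<infinity> = 0. *)
definition ext_convex :: "('a::real_vector \<Rightarrow> ereal) \<Rightarrow> bool" where
  "ext_convex f \<longleftrightarrow> (\<forall>x y. \<forall>u\<in>{0<..<1}.
     f (u *\<^sub>R x + (1 - u) *\<^sub>R y) \<le> ereal u * f x + ereal (1 - u) * f y)"

(* For proper f the set is empty at points outside the effective domain. *)
definition subdifferential :: "('a::real_inner \<Rightarrow> ereal) \<Rightarrow> 'a \<Rightarrow> 'a set" where
  "subdifferential f z = {g. \<forall>y. f z + ereal (g \<bullet> (y - z)) \<le> f y}"

(* The multiple \<epsilon>\<psi>; for \<epsilon> = 0 it is by convention the indicator function of the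
   effective domain, not the zero function. *)
definition scale_fun :: "real \<Rightarrow> ('a \<Rightarrow> ereal) \<Rightarrow> 'a \<Rightarrow> ereal" where
  "scale_fun \<epsilon> f x =
     (if \<epsilon> = 0 then (if x \<in> eff_dom f then 0 else \<infinity>) else ereal \<epsilon> * f x)"

(* f is differentiable at z with gradient g.  Finiteness of f near z is required
   separately because real_of_ereal sends \<infinity> to 0. *)
definition ext_has_gradient :: "('a::real_inner \<Rightarrow> ereal) \<Rightarrow> 'a \<Rightarrow> 'a \<Rightarrow> bool" where
  "ext_has_gradient f z g \<longleftrightarrow>
     (\<forall>\<^sub>F x in nhds z. \<bar>f x\<bar> \<noteq> \<infinity>) \<and> (GDERIV (\<lambda>x. real_of_ereal (f x)) z :> g)"

end

theory Submission
  imports Defs "HOL-Probability.Distributions"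
begin

text \<open>
  Translating by \<open>w\<close> multiplies the Gaussian density by
  \<open>exp (- x \<bullet> w - \<parallel>w\<parallel>\<^sup>2 / 2)\<close>. With \<open>t = \<parallel>w\<parallel> / sqrt n\<close>, the AM-GM inequality bounds the
  linear term \<open>\<parallel>w\<parallel> \<parallel>x\<parallel>\<close> by \<open>(t \<parallel>x\<parallel>\<^sup>2 + \<parallel>w\<parallel> sqrt n) / 2\<close>, which only rescales the
  Gaussian, and on a cone such a rescaling changes the mass by the explicit factor
  \<open>(1 + t) powr (- n / 2) \<ge> exp (- \<parallel>w\<parallel> sqrt n / 2)\<close>. The upper bound uses the same device after
  splitting the shift into its projection \<open>p\<close> onto the dual cone and a remainder \<open>- q\<close> with
  \<open>p \<bullet> q = 0\<close>; now the variance is multiplied by \<open>1 + t\<close>, \<open>t = \<parallel>q\<parallel> / sqrt n\<close>, and the term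
  \<open>p \<bullet> x \<ge> 0\<close> is dropped.
\<close>

section \<open>Unnormalised Gaussian mass and its finiteness\<close>

text \<open>The factor \<open>(2 * pi) powr (- n / 2)\<close> is left out because it cancels in
  every comparison of masses; values in \<open>ennreal\<close> spare integrability side
  conditions.\<close>

definition gauss_mass :: "'a::euclidean_space set \<Rightarrow> ennreal" where
  "gauss_mass S = (\<integral>\<^sup>+x. ennreal (exp (- (norm x)\<^sup>2 / 2)) * indicator S x \<partial>lborel)"

lemma gauss_mass_mono: "S \<subseteq> S' \<Longrightarrow> gauss_mass S \<le> gauss_mass S'"
  unfolding gauss_mass_def
  by (intro nn_integral_mono mult_left_mono) (auto simp: indicator_def)

lemma nn_integral_exp_square_finite: "(\<integral>\<^sup>+x. ennreal (exp (- x\<^sup>2 / 2)) \<partial>lborel) < \<infinity>"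
proof -
  have "has_bochner_integral lborel (\<lambda>x::real. exp (- x\<^sup>2 / 2)) (sqrt (2 * pi))"
  proof -
    have i: "integrable lborel std_normal_density"
      by (rule integrable_normal_density) simp
    have "integrable lborel (\<lambda>x. sqrt (2 * pi) * std_normal_density x)"
      using i by simp
    moreover have "(\<integral>x. sqrt (2 * pi) * std_normal_density x \<partial>lborel) = sqrt (2 * pi)"
      by simp
    ultimately show ?thesis
      by (simp add: has_bochner_integral_iff std_normal_density_def)
  qed
  then have "(\<integral>\<^sup>+x. ennreal (exp (- x\<^sup>2 / 2)) \<partial>lborel) = ennreal (sqrt (2 * pi))"
    by (simp add: has_bochner_integral_iff nn_integral_eq_integral)
  then show ?thesis by simp
qed

text \<open>Over the whole space the integrand factors along the basis into one-dimensional
  Gaussians.\<close>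

lemma gauss_mass_finite: "gauss_mass (S :: 'a::euclidean_space set) < \<infinity>"
proof -
  have "gauss_mass S \<le> gauss_mass (UNIV :: 'a set)"
    by (rule gauss_mass_mono) simp
  also have "gauss_mass (UNIV :: 'a set)
      = (\<integral>\<^sup>+x. (\<Prod>b\<in>(Basis :: 'a set). ennreal (exp (- (x \<bullet> b)\<^sup>2 / 2))) \<partial>lborel)"
    unfolding gauss_mass_def
  proof (rule nn_integral_cong)
    fix x :: 'a
    have "- (norm x)\<^sup>2 / 2 = (\<Sum>b\<in>Basis. - (x \<bullet> b)\<^sup>2 / 2)"
      unfolding power2_norm_eq_inner euclidean_inner[of x x]
      by (simp add: sum_negf sum_divide_distrib power2_eq_square)
    then show "ennreal (exp (- (norm x)\<^sup>2 / 2)) * indicator UNIV x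
        = (\<Prod>b\<in>Basis. ennreal (exp (- (x \<bullet> b)\<^sup>2 / 2)))"
      by (simp add: exp_sum prod_ennreal)
  qed
  also have "\<dots> = (\<Prod>b\<in>(Basis :: 'a set). \<integral>\<^sup>+y. ennreal (exp (- y\<^sup>2 / 2)) \<partial>lborel)"
    by (rule nn_integral_lborel_prod) auto
  also have "\<dots> < \<infinity>"
    using nn_integral_exp_square_finite by (simp add: power_less_top_ennreal)
  finally show ?thesis .
qed

section \<open>Translations and dilations of Lebesgue measure\<close>

lemma translate_in_borel:
  fixes S :: "'a::euclidean_space set"
  assumes [measurable]: "S \<in> sets borel"
  shows "(\<lambda>x. x + w) ` S \<in> sets borel"
proof -
  have "(\<lambda>x. x + w) ` S = (\<lambda>x. x - w) -` S \<inter> space borel"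
    by (auto simp: image_iff) (metis diff_add_cancel)
  also have "\<dots> \<in> sets borel" by measurable
  finally show ?thesis .
qed

lemma nn_integral_lborel_translate:
  fixes w :: "'a::euclidean_space"
  assumes [measurable]: "f \<in> borel_measurable borel"
  shows "(\<integral>\<^sup>+x. f x \<partial>lborel) = (\<integral>\<^sup>+x. f (w + x) \<partial>lborel)"
  by (subst lborel_distr_plus[of w, symmetric], subst nn_integral_distr) auto

lemma nn_integral_lborel_scaleR:
  fixes f :: "'a::euclidean_space \<Rightarrow> ennreal"
  assumes [measurable]: "f \<in> borel_measurable borel" and c: "c > 0"
  shows "(\<integral>\<^sup>+x. f x \<partial>lborel) = ennreal (c ^ DIM('a)) * (\<integral>\<^sup>+x. f (c *\<^sub>R x) \<partial>lborel)"
  using c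
  by (subst lborel_affine[of c 0])
    (auto simp: nn_integral_density nn_integral_distr nn_integral_cmult)

text \<open>Substituting \<open>sqrt s *\<^sub>R x\<close> turns one exponent into the other with
  Jacobian \<open>sqrt s ^ DIM('a)\<close>, and a cone is invariant under positive dilations, so the
  indicator does not change.\<close>

lemma gauss_mass_cone_rescale:
  fixes S :: "'a::euclidean_space set"
  assumes [measurable]: "S \<in> sets borel" and cone: "cone S" and s: "s > 0"
  shows "(\<integral>\<^sup>+x. ennreal (exp (- s * (norm x)\<^sup>2 / 2)) * indicator S x \<partial>lborel)
    = ennreal (s powr (- real DIM('a) / 2)) * gauss_mass S"
    (is "?I = _")
proof -
  have mem: "sqrt s *\<^sub>R x \<in> S \<longleftrightarrow> x \<in> S" for x
  proof
    assume "sqrt s *\<^sub>R x \<in> S"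
    then have "inverse (sqrt s) *\<^sub>R sqrt s *\<^sub>R x \<in> S"
      using s cone unfolding cone_def by (meson inverse_nonnegative_iff_nonnegative less_imp_le real_sqrt_ge_zero)
    then show "x \<in> S" using s by simp
  qed (use cone s in \<open>auto simp: cone_def\<close>)
  have "gauss_mass S = ennreal (sqrt s ^ DIM('a)) * ?I"
    unfolding gauss_mass_def
    using s by (subst nn_integral_lborel_scaleR[where c = "sqrt s"])
      (auto simp: power_mult_distrib indicator_def mem)
  also have "sqrt s ^ DIM('a) = s powr (real DIM('a) / 2)"
    using s by (simp add: powr_half_sqrt[symmetric] powr_powr flip: powr_realpow)
  finally have "ennreal (s powr (- real DIM('a) / 2)) * gauss_mass S
      = ennreal (s powr (- real DIM('a) / 2) * s powr (real DIM('a) / 2)) * ?I"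
    by (simp add: ennreal_mult' mult.assoc)
  also have "s powr (- real DIM('a) / 2) * s powr (real DIM('a) / 2) = 1"
    using s by (simp flip: powr_add)
  finally show ?thesis by simp
qed

text \<open>This is \<open>ln (1 + t) \<le> t\<close>. With \<open>a = n / 2\<close> and
  \<open>t = r / sqrt n\<close> the exponent becomes \<open>r * sqrt n / 2\<close>, the cost of the
  dilation.\<close>

lemma one_plus_powr_le_exp:
  assumes "t \<ge> 0" "a \<ge> (0::real)"
  shows "(1 + t) powr a \<le> exp (a * t)"
proof -
  have "a * ln (1 + t) \<le> a * t"
    using assms ln_add_one_self_le_self[of t] by (intro mult_left_mono) auto
  then show ?thesis using assms by (simp add: powr_def)
qed

section \<open>Mass of a translated cone\<close>

lemma gauss_mass_translate_ge:
  fixes S :: "'a::euclidean_space set"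
  assumes [measurable]: "S \<in> sets borel" and cone: "cone S"
  shows "gauss_mass S * ennreal (exp (- (1/2) * (norm w)\<^sup>2 - norm w * sqrt (real DIM('a))))
    \<le> gauss_mass ((\<lambda>x. x + w) ` S)"
proof -
  \<comment> \<open>For \<open>t > 0\<close>, AM-GM costs \<open>r\<^sup>2 / (2 * t)\<close> in the
    exponent and the dilation at most \<open>n * t / 2\<close>; this \<open>t\<close> minimises the
    sum, making both equal to \<open>r * sqrt n / 2\<close> when \<open>r > 0\<close>.\<close>
  define n r t k where "n = real DIM('a)" and "r = norm w"
    and "t = r / sqrt n" and "k = exp (- r\<^sup>2 / 2 - r * sqrt n / 2)"
  have n: "n > 0" by (simp add: n_def)
  have r: "r \<ge> 0" by (simp add: r_def)
  have t: "t \<ge> 0" using n r by (simp add: t_def)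
  \<comment> \<open>Using this identity instead of dividing by \<open>t\<close> covers
    \<open>w = 0\<close> without a separate case.\<close>
  have rt: "r = t * sqrt n" using n by (simp add: t_def)
  have [measurable]: "(\<lambda>x. x + w) ` S \<in> sets borel"
    by (rule translate_in_borel) fact
  have pointwise: "k * exp (- (1 + t) * (norm x)\<^sup>2 / 2) \<le> exp (- (norm (w + x))\<^sup>2 / 2)" for x :: 'a
  proof -
    have "w \<bullet> x \<le> r * norm x" unfolding r_def by (rule norm_cauchy_schwarz)
    \<comment> \<open>The expanded square has cross term \<open>- 2 * r * norm x\<close> and
      constant term \<open>t * n = r * sqrt n\<close>.\<close>
    moreover have "0 \<le> t * (norm x - sqrt n)\<^sup>2" using t by simp
    then have "2 * (r * norm x) \<le> t * (norm x)\<^sup>2 + r * sqrt n"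
      using n by (simp add: rt power2_diff algebra_simps)
    moreover have "(norm (w + x))\<^sup>2 = r\<^sup>2 + 2 * (w \<bullet> x) + (norm x)\<^sup>2"
      by (simp add: r_def power2_norm_eq_inner inner_add inner_commute)
    ultimately show ?thesis
      unfolding k_def exp_add[symmetric] by (simp add: field_simps)
  qed
  have "exp (- (1/2) * r\<^sup>2 - r * sqrt n) \<le> k * (1 + t) powr (- n / 2)"
  proof -
    have "(1 + t) powr (n / 2) \<le> exp (r * sqrt n / 2)"
      using one_plus_powr_le_exp[of t "n / 2"] t n by (simp add: rt mult_ac)
    then have "exp (- (r * sqrt n / 2)) \<le> (1 + t) powr (- n / 2)"
      using t by (simp add: exp_minus powr_minus le_imp_inverse_le)
    then have "k * exp (- (r * sqrt n / 2)) \<le> k * (1 + t) powr (- n / 2)"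
      by (simp add: k_def)
    moreover have "k * exp (- (r * sqrt n / 2)) = exp (- (1/2) * r\<^sup>2 - r * sqrt n)"
      unfolding k_def exp_add[symmetric] by (simp add: field_simps)
    ultimately show ?thesis by (simp only:)
  qed
  then have "gauss_mass S * ennreal (exp (- (1/2) * r\<^sup>2 - r * sqrt n))
      \<le> gauss_mass S * ennreal (k * (1 + t) powr (- n / 2))"
    by (intro mult_left_mono ennreal_leI) auto
  also have "\<dots> = ennreal k * (ennreal ((1 + t) powr (- n / 2)) * gauss_mass S)"
    by (simp add: ennreal_mult k_def mult_ac)
  also have "\<dots> = (\<integral>\<^sup>+x. ennreal k * (ennreal (exp (- (1 + t) * (norm x)\<^sup>2 / 2)) * indicator S x) \<partial>lborel)"
    using t by (subst gauss_mass_cone_rescale[symmetric, OF _ cone, folded n_def])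
      (auto simp: nn_integral_cmult n_def)
  also have "\<dots> \<le> (\<integral>\<^sup>+x. ennreal (exp (- (norm (w + x))\<^sup>2 / 2)) * indicator S x \<partial>lborel)"
    using pointwise
    by (intro nn_integral_mono)
      (auto simp: indicator_def k_def simp flip: ennreal_mult' intro!: ennreal_leI)
  also have "\<dots> = (\<integral>\<^sup>+x. ennreal (exp (- (norm (w + x))\<^sup>2 / 2)) * indicator ((\<lambda>x. x + w) ` S) (w + x) \<partial>lborel)"
    by (intro nn_integral_cong) (auto simp: indicator_def add.commute[of w])
  also have "\<dots> = gauss_mass ((\<lambda>x. x + w) ` S)"
    unfolding gauss_mass_def
    by (subst nn_integral_lborel_translate[where w = w, symmetric]) auto
  finally show ?thesis by (simp add: n_def r_def)
qed

text \<open>Orthogonality splits the squared norm of the shift into those of \<open>p\<close> and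
  \<open>q\<close>. The part from \<open>p\<close> survives in the bound, while the part from
  \<open>q\<close> absorbs the surplus \<open>r\<^sup>2\<close> produced by AM-GM.\<close>

lemma gauss_mass_translate_le:
  fixes S :: "'a::euclidean_space set"
  assumes S [measurable]: "S \<in> sets borel" and cone: "cone S"
    and p: "p \<in> dual_cone S" and orth: "p \<bullet> q = 0"
  shows "gauss_mass ((\<lambda>x. x + (p - q)) ` S)
    \<le> gauss_mass S * ennreal (exp (- (1/2) * (norm p)\<^sup>2 + norm q * sqrt (real DIM('a))))"
proof -
  define n r t k where "n = real DIM('a)" and "r = norm q"
    and "t = r / sqrt n" and "k = exp (- (norm p)\<^sup>2 / 2 + r * sqrt n / 2)"
  define v where "v = p - q"
  have n: "n > 0" by (simp add: n_def)
  have r: "r \<ge> 0" by (simp add: r_def)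
  have t: "t \<ge> 0" using n r by (simp add: t_def)
  have rt: "r = t * sqrt n" using n by (simp add: t_def)
  have [measurable]: "(\<lambda>x. x + v) ` S \<in> sets borel"
    by (rule translate_in_borel) fact
  have pointwise: "exp (- (norm (v + x))\<^sup>2 / 2) \<le> k * exp (- (1 / (1 + t)) * (norm x)\<^sup>2 / 2)"
    if "x \<in> S" for x :: 'a
  proof -
    have px: "p \<bullet> x \<ge> 0" using p that by (auto simp: dual_cone_def)
    have qx: "q \<bullet> x \<le> r * norm x" unfolding r_def by (rule norm_cauchy_schwarz)
    \<comment> \<open>The enlarged variance is \<open>1 / c\<close>, so \<open>1 - c = t * c\<close>
      is the quadratic coefficient available to absorb the linear term.\<close>
    define c where "c = 1 / (1 + t)"
    have c: "1 - c = t * c" "c * (1 + t) = 1" "c > 0"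
      using t by (auto simp: c_def field_simps)
    \<comment> \<open>This is AM-GM with weight \<open>t * c\<close>, scaled so that the cross term
      is exactly \<open>2 * r * norm x\<close>; the constant \<open>t * n * (1 + t)\<close> equals
      \<open>r * sqrt n + r\<^sup>2\<close>.\<close>
    have "0 \<le> t * (c * norm x - sqrt n)\<^sup>2 * (1 + t)" using t by simp
    also have "\<dots> = t * c * (c * (1 + t)) * (norm x)\<^sup>2 + t * n * (1 + t)
        - 2 * (t * sqrt n * norm x * (c * (1 + t)))"
      using n by (simp add: power2_diff power_mult_distrib) (simp add: power2_eq_square algebra_simps)
    also have "\<dots> = (1 - c) * (norm x)\<^sup>2 + r\<^sup>2 + r * sqrt n - 2 * (r * norm x)"
      using n by (simp add: c rt power_mult_distrib mult.assoc) (simp add: power2_eq_square algebra_simps)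
    finally have "2 * (r * norm x) \<le> (norm x)\<^sup>2 - c * (norm x)\<^sup>2 + r\<^sup>2 + r * sqrt n"
      by (simp add: left_diff_distrib)
    moreover have "(norm (v + x))\<^sup>2 = (norm p)\<^sup>2 + r\<^sup>2 + 2 * (p \<bullet> x) - 2 * (q \<bullet> x) + (norm x)\<^sup>2"
      using orth by (simp add: v_def r_def power2_norm_eq_inner inner_add inner_diff inner_commute)
    ultimately have "- (norm (v + x))\<^sup>2 / 2
        \<le> (- (norm p)\<^sup>2 / 2 + r * sqrt n / 2) + (- c * (norm x)\<^sup>2 / 2)"
      using px qx by (simp add: field_simps)
    then show ?thesis
      unfolding k_def exp_add[symmetric] c_def by simp
  qed
  have bound: "k * (1 / (1 + t)) powr (- n / 2) \<le> exp (- (1/2) * (norm p)\<^sup>2 + r * sqrt n)"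
  proof -
    have "(1 / (1 + t)) powr (- n / 2) = (1 + t) powr (n / 2)"
      using t by (simp add: powr_divide powr_minus)
    also have "\<dots> \<le> exp (r * sqrt n / 2)"
      using one_plus_powr_le_exp[of t "n / 2"] t n by (simp add: rt mult_ac)
    finally have "k * (1 / (1 + t)) powr (- n / 2) \<le> k * exp (r * sqrt n / 2)"
      by (simp add: k_def)
    then show ?thesis by (simp add: k_def flip: exp_add)
  qed
  have "gauss_mass ((\<lambda>x. x + v) ` S)
      = (\<integral>\<^sup>+x. ennreal (exp (- (norm (v + x))\<^sup>2 / 2)) * indicator ((\<lambda>x. x + v) ` S) (v + x) \<partial>lborel)"
    unfolding gauss_mass_def
    by (subst nn_integral_lborel_translate[where w = v]) auto
  also have "\<dots> \<le> (\<integral>\<^sup>+x. ennreal k * (ennreal (exp (- (1 / (1 + t)) * (norm x)\<^sup>2 / 2)) * indicator S x) \<partial>lborel)"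
    using pointwise
    by (intro nn_integral_mono)
      (auto simp: indicator_def k_def add.commute[of v] simp flip: ennreal_mult' intro!: ennreal_leI)
  also have "\<dots> = ennreal k * (ennreal ((1 / (1 + t)) powr (- n / 2)) * gauss_mass S)"
    using t by (subst gauss_mass_cone_rescale[symmetric, OF _ cone, folded n_def])
      (auto simp: nn_integral_cmult n_def)
  also have "\<dots> = gauss_mass S * ennreal (k * (1 / (1 + t)) powr (- n / 2))"
    by (simp add: ennreal_mult k_def mult_ac)
  also have "\<dots> \<le> gauss_mass S * ennreal (exp (- (1/2) * (norm p)\<^sup>2 + r * sqrt n))"
    using bound by (intro mult_left_mono ennreal_leI) auto
  finally show ?thesis by (simp add: n_def r_def v_def)
qed

section \<open>Passage from unnormalised mass to the Gaussian measure\<close>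

lemma measure_std_gaussian:
  fixes S :: "(real ^ 'n) set"
  assumes [measurable]: "S \<in> sets borel"
  shows "measure std_gaussian S
    = (2 * pi) powr (- real CARD('n) / 2) * enn2real (gauss_mass S)"
proof -
  define c where "c = (2 * pi) powr (- real CARD('n) / 2)"
  have "emeasure (std_gaussian :: (real ^ 'n) measure) S
      = (\<integral>\<^sup>+x. ennreal c * (ennreal (exp (- (norm x)\<^sup>2 / 2)) * indicator S x) \<partial>lborel)"
    unfolding std_gaussian_def c_def[symmetric]
    by (subst emeasure_density)
      (auto simp: ennreal_mult c_def mult.assoc intro!: nn_integral_cong)
  also have "\<dots> = ennreal c * gauss_mass S"
    unfolding gauss_mass_def by (subst nn_integral_cmult) auto
  finally show ?thesis
    by (simp add: measure_def enn2real_mult c_def)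
qed

text \<open>Factors on both sides let one lemma serve both bounds: \<open>b = 1\<close> for the
  lower one, \<open>a = 1\<close> for the upper one.\<close>

lemma measure_std_gaussian_le:
  fixes S S' :: "(real ^ 'n) set"
  assumes "S \<in> sets borel" "S' \<in> sets borel" "a \<ge> 0" "b \<ge> 0"
    and "gauss_mass S * ennreal a \<le> gauss_mass S' * ennreal b"
  shows "measure std_gaussian S * a \<le> measure std_gaussian S' * b"
proof -
  \<comment> \<open>\<open>enn2real\<close> sends \<infinity> to 0, so it is monotone only below a
    finite bound.\<close>
  have "gauss_mass S' * ennreal b < \<infinity>"
    using gauss_mass_finite[of S'] by (simp add: ennreal_mult_less_top)
  then have "enn2real (gauss_mass S * ennreal a) \<le> enn2real (gauss_mass S' * ennreal b)"
    using assms by (intro enn2real_mono) auto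
  then have "(2 * pi) powr (- real CARD('n) / 2) * (enn2real (gauss_mass S) * a)
      \<le> (2 * pi) powr (- real CARD('n) / 2) * (enn2real (gauss_mass S') * b)"
    using assms by (intro mult_left_mono) (auto simp: enn2real_mult)
  then show ?thesis using assms by (simp add: measure_std_gaussian mult.assoc)
qed

section \<open>Normal cones, dual cones and projection\<close>

lemma closed_normal_cone: "closed (normal_cone Q x)"
proof -
  have "normal_cone Q x = (\<Inter>y\<in>Q. {v. v \<bullet> (y - x) \<le> 0})"
    by (auto simp: normal_cone_def)
  moreover have "closed {v. v \<bullet> (y - x) \<le> 0}" for y
    by (intro closed_Collect_le continuous_intros)
  ultimately show ?thesis by (simp add: closed_INT)
qed

lemma cone_normal_cone: "cone (normal_cone Q x)"
  by (auto simp: cone_def normal_cone_def mult_nonneg_nonpos)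

lemma normal_cone_add:
  "v \<in> normal_cone Q x \<Longrightarrow> w \<in> normal_cone Q x \<Longrightarrow> v + w \<in> normal_cone Q x"
  by (auto simp: normal_cone_def inner_add_left) (meson add_nonpos_nonpos)

lemma closed_dual_cone: "closed (dual_cone S)"
proof -
  have "dual_cone S = (\<Inter>x\<in>S. {y. 0 \<le> y \<bullet> x})"
    by (auto simp: dual_cone_def)
  moreover have "closed {y. 0 \<le> y \<bullet> x}" for x :: 'a
    by (intro closed_Collect_le continuous_intros)
  ultimately show ?thesis by (simp add: closed_INT)
qed

lemma convex_dual_cone: "convex (dual_cone S)"
  by (auto simp: convex_def dual_cone_def inner_add_left)

lemma zero_in_dual_cone: "0 \<in> dual_cone S"
  by (auto simp: dual_cone_def)

lemma scaleR_in_dual_cone: "c \<ge> 0 \<Longrightarrow> y \<in> dual_cone S \<Longrightarrow> c *\<^sub>R y \<in> dual_cone S"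
  by (auto simp: dual_cone_def)

text \<open>The variational inequality of the projection, tested at \<open>0\<close> and at
  \<open>2 *\<^sub>R p\<close>, gives both signs. Hence \<open>v = p - (p - v)\<close> is an
  orthogonal splitting (Moreau decomposition).\<close>

lemma closest_point_dual_cone_orthogonal:
  fixes S :: "'a::euclidean_space set" and v :: 'a
  defines "p \<equiv> closest_point (dual_cone S) v"
  shows "p \<bullet> (p - v) = 0"
proof -
  have p: "p \<in> dual_cone S"
    unfolding p_def using closed_dual_cone zero_in_dual_cone
    by (intro closest_point_in_set) auto
  have "(v - p) \<bullet> (y - p) \<le> 0" if "y \<in> dual_cone S" for y
    unfolding p_def using that by (rule closest_point_dot[OF convex_dual_cone closed_dual_cone])
  from this[OF zero_in_dual_cone] this[OF scaleR_in_dual_cone[OF _ p, of 2]]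
  show ?thesis by (simp add: inner_diff inner_commute)
qed

section \<open>Measurability of the Minkowski sums\<close>

text \<open>Each \<open>y\<close> contributes a closed half-space (or everything, or nothing) when
  both values are finite; an infinite value gives the whole space or the empty set.\<close>

lemma closed_subdifferential: "closed (subdifferential f z)"
proof -
  have "subdifferential f z = (\<Inter>y. {g. f z + ereal (g \<bullet> (y - z)) \<le> f y})"
    by (auto simp: subdifferential_def)
  moreover have "closed {g. f z + ereal (g \<bullet> (y - z)) \<le> f y}" for y
  proof (cases "f z")
    case (real a)
    show ?thesis
    proof (cases "f y")
      case (real b)
      have "closed {g. a + g \<bullet> (y - z) \<le> b}"
        by (intro closed_Collect_le continuous_intros)
      then show ?thesis using \<open>f z = ereal a\<close> real by simp
    qed (use real in auto)
  qed auto
  ultimately show ?thesis by (simp add: closed_INT)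
qed

text \<open>The sum of two closed sets need not be closed, but it is a countable union of closed sets.\<close>
lemma closed_plus_in_borel:
  fixes S U :: "'a::euclidean_space set"
  assumes "closed S" "closed U"
  shows "S + U \<in> sets borel"
proof -
  define K where "K k = S \<inter> cball 0 (real k)" for k :: nat
  have "compact (K k)" for k
    unfolding K_def using \<open>closed S\<close> by (simp add: closed_Int_compact)
  then have "closed (\<Union>x\<in>K k. \<Union>y\<in>U. {x + y})" for k
    using assms compact_closed_sums by metis
  then have "(\<Union>k. \<Union>x\<in>K k. \<Union>y\<in>U. {x + y}) \<in> sets borel"
    by (intro sets.countable_UN) auto
  also have "(\<Union>k. \<Union>x\<in>K k. \<Union>y\<in>U. {x + y}) = (\<Union>x\<in>\<Union>(range K). \<Union>y\<in>U. {x + y})"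
    by blast
  also have "\<Union>(range K) = S"
    by (auto simp: K_def real_arch_simple)
  also have "(\<Union>x\<in>S. \<Union>y\<in>U. {x + y}) = S + U"
    by (auto simp: set_plus_def)
  finally show ?thesis .
qed

section \<open>Assembly of the lower and the upper bound\<close>

theorem theorem2p1:
  fixes A :: "real ^ 'n ^ 'm" and b :: "real ^ 'm"
    and Q T :: "(real ^ 'n) set"
    and \<psi> :: "real ^ 'n \<Rightarrow> ereal"
    and z :: "real ^ 'n" and \<epsilon> :: real
  assumes Q_def: "Q = {x. A *v x \<le> b}" and Q_nonempty: "Q \<noteq> {}"
    and psi_proper: "proper_fun \<psi>" and psi_convex: "ext_convex \<psi>"
    and z_vertex: "z extreme_point_of Q"
    and eps_nonneg: "\<epsilon> \<ge> 0"
    and T_def: "T = normal_cone Q z"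
  shows "(\<forall>w \<in> subdifferential (scale_fun \<epsilon> \<psi>) z \<inter> T.
            measure std_gaussian (T \<inter> (T + subdifferential (scale_fun \<epsilon> \<psi>) z))
              \<ge> measure std_gaussian T
                  * exp (- (1/2) * (norm w)\<^sup>2 - norm w * sqrt (real CARD('n))))
       \<and> (\<forall>g. ext_has_gradient \<psi> z g \<longrightarrow>
            measure std_gaussian (T \<inter> (T + {\<epsilon> *\<^sub>R g}))
              \<le> measure std_gaussian T
                  * exp (- (1/2) * (norm (closest_point (dual_cone T) (\<epsilon> *\<^sub>R g)))\<^sup>2
                         + infdist (\<epsilon> *\<^sub>R g) (dual_cone T) * sqrt (real CARD('n))))"
proof -
  have T_borel: "T \<in> sets borel" and T_cone: "cone T"
    using closed_normal_cone cone_normal_cone by (auto simp: T_def intro: borel_closed)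
  show ?thesis
  proof (intro conjI ballI allI impI)
    let ?D = "subdifferential (scale_fun \<epsilon> \<psi>) z"
    \<comment> \<open>\<open>measure\<close> is 0 on nonmeasurable sets, so a lower bound requires
      measurability of the sum.\<close>
    have sum_borel: "T + ?D \<in> sets borel"
      unfolding T_def by (rule closed_plus_in_borel[OF closed_normal_cone closed_subdifferential])
    fix w assume w: "w \<in> ?D \<inter> T"
    \<comment> \<open>The translate stays in \<open>T\<close> because \<open>w\<close> lies in the
      additively closed \<open>T\<close>, and in the sum because \<open>w\<close> is a
      subgradient.\<close>
    have "(\<lambda>x. x + w) ` T \<subseteq> T \<inter> (T + ?D)"
      using w normal_cone_add by (auto simp: T_def set_plus_def)
    then have "gauss_mass ((\<lambda>x. x + w) ` T) \<le> gauss_mass (T \<inter> (T + ?D))"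
      by (rule gauss_mass_mono)
    from order_trans[OF gauss_mass_translate_ge[OF T_borel T_cone] this]
    show "measure std_gaussian (T \<inter> (T + ?D))
        \<ge> measure std_gaussian T * exp (- (1/2) * (norm w)\<^sup>2 - norm w * sqrt (real CARD('n)))"
      using measure_std_gaussian_le[OF T_borel sets.Int[OF T_borel sum_borel], where b = 1]
      by simp
  next
    fix g
    define v p where "v = \<epsilon> *\<^sub>R g" and "p = closest_point (dual_cone T) v"
    have p: "p \<in> dual_cone T"
      unfolding p_def using closed_dual_cone zero_in_dual_cone
      by (intro closest_point_in_set) auto
    \<comment> \<open>The dual cone contains 0, so \<open>infdist\<close> is a genuine infimum and
      not the default 0 of the empty set.\<close>
    have norm_le: "norm (p - v) \<le> infdist v (dual_cone T)"
    proof -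
      have "norm (p - v) \<le> dist v y" if "y \<in> dual_cone T" for y
        using closest_point_le[OF closed_dual_cone that, of v]
        by (simp add: p_def dist_norm norm_minus_commute)
      then show ?thesis
        using zero_in_dual_cone[of T] by (auto simp: infdist_def intro!: cINF_greatest)
    qed
    have sum_borel: "T + {v} \<in> sets borel"
      unfolding T_def by (rule closed_plus_in_borel[OF closed_normal_cone closed_singleton])
    have sum_eq: "T + {v} = (\<lambda>x. x + v) ` T"
      by (auto simp: set_plus_def)
    \<comment> \<open>Intersecting with \<open>T\<close> is dropped by monotonicity, and the shift
      \<open>v\<close> is written as \<open>p - q\<close> with \<open>q = p - v\<close>.\<close>
    have "gauss_mass (T \<inter> (T + {v})) \<le> gauss_mass ((\<lambda>x. x + (p - (p - v))) ` T)"
      by (intro gauss_mass_mono) (auto simp: sum_eq)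
    also have "\<dots> \<le> gauss_mass T * ennreal (exp (- (1/2) * (norm p)\<^sup>2 + norm (p - v) * sqrt (real CARD('n))))"
      using gauss_mass_translate_le[OF T_borel T_cone p, of "p - v"]
        closest_point_dual_cone_orthogonal[of T v] by (simp add: p_def)
    also have "\<dots> \<le> gauss_mass T * ennreal (exp (- (1/2) * (norm p)\<^sup>2
        + infdist v (dual_cone T) * sqrt (real CARD('n))))"
      using norm_le by (intro mult_left_mono ennreal_leI) (auto intro: mult_right_mono)
    finally show "measure std_gaussian (T \<inter> (T + {\<epsilon> *\<^sub>R g}))
        \<le> measure std_gaussian T
            * exp (- (1/2) * (norm (closest_point (dual_cone T) (\<epsilon> *\<^sub>R g)))\<^sup>2
                   + infdist (\<epsilon> *\<^sub>R g) (dual_cone T) * sqrt (real CARD('n)))"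
      using measure_std_gaussian_le[OF sets.Int[OF T_borel sum_borel] T_borel, where a = 1]
      by (simp add: v_def p_def)
  qed
qed

end
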